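(* Consider named agents, and any of the twelve models obtained by choosing synchronous or asynchronous timing, a whiteboard capacity among NW, CW, FW, and half-duplex or full-duplex links. For every number of agents $k \ge 1$, there exists no $k$-quiescent self-stabilizing solution to the $k$-gossip problem in that model.
   Context: Network: a finite connected graph $G=(V,E)$. Nodes are anonymous (nodes of the same degree are identical). Each node labels its incident links with locally distinct labels; nothing else is assumed about the labels. Each node has a whiteboard (a public memory). Agents: $k$ mobile agents, each a deterministic state machine, are present at all times. In the named agent model each agent has a unique constant identifier from an infinite totally ordered domain (e.g. $\mathbb{N}$). When an agent at a node executes its action, it may change its state, write on the node's whiteboard, and move to a neighboring node (or stay), based only on: its own state (and identifier), the states of the agents currently at the same node, the local link labels of the node (and possibly the label of the incoming link), and the contents of the node's whiteboard. The algorithm is the same for all agents; it is given neither $k$ nor the network. Synchrony. Synchronous: lock-step rounds; in each round every agent executes its action and can move to a neighboring node; agents at the same node act in sequence within the round. (In this model whiteboards of type CW or FW may also hold count-up timers that are increased by one automatically at every round.) Asynchronous: there is no bound on the number of moves an agent can make between two moves of another agent, but each agent is always eventually allowed to execute its action; agents at the same node act sequentially, agents at different nodes may act concurrently. Links. Full-duplex: two agents at neighboring nodes can swap positions simultaneously over the link joining them without meeting. Half-duplex: only one direction can be used at a time; if two agents at opposite ends try to cross simultaneously, only one succeeds. Whiteboards. NW: no information can be stored. CW: only control information can be stored, not gossip information. FW: any information can be stored, including gossip information. $k$-gossip problem: each of the $k$ agents is given an initial piece of information (gossip information), treated as opaque. Gossip information is transferred from agent to agent by meeting at a node or, for FW only,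 by being written on and read from a whiteboard; agents may relay all gossip information collected. The goal is that every agent obtains the gossip information of all agents. Self-stabilizing solution: one algorithm, not depending on $k$ or on the network, such that for every network, every number of agents, and every initial configuration (arbitrary agent locations and states, arbitrary whiteboard contents), in every execution every agent eventually knows the gossip information of all agents in the system. $l$-quiescent (for an integer $l$, when $k$ agents are present): every execution with $k$ agents reaches a configuration after which $l$ or more agents remain still (never move) forever. *)

theory Defs
  imports Main "HOL-Library.Infinite_Set" "HOL-Library.Infinite_Typeclass"
begin

section \<open>The twelve models\<close>

datatype timing = Synchronous | Asynchronous
datatype capacity = NW | CW | FW
datatype duplexity = Half_Duplex | Full_Duplex

record model =
  timing :: timing
  capacity :: capacity
  duplexity :: duplexity


section \<open>Networks\<close>

text \<open>
  An undirected edge \<open>uv\<close> is represented by the two pairs \<open>(u, v)\<close> and \<open>(v, u)\<close>;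
  \<open>label u v\<close> is the label that node \<open>u\<close> gives to its link towards \<open>v\<close>. Node names only
  serve to describe the network: they are never shown to an agent.
\<close>

record 'l network =
  nodes :: "nat set"
  edges :: "(nat \<times> nat) set"
  label :: "nat \<Rightarrow> nat \<Rightarrow> 'l"

definition network :: "'l network \<Rightarrow> bool" where
  "network N \<longleftrightarrow>
     finite (nodes N) \<and> nodes N \<noteq> {} \<and>
     edges N \<subseteq> nodes N \<times> nodes N \<and> sym (edges N) \<and> irrefl (edges N) \<and>
     (\<forall>u\<in>nodes N. \<forall>v\<in>nodes N. (u, v) \<in> (edges N)\<^sup>*) \<and>
     (\<forall>u\<in>nodes N. inj_on (label N u) (edges N `` {u}))"

definition ports :: "'l network \<Rightarrow> nat \<Rightarrow> 'l set" where
  "ports N u = label N u ` (edges N `` {u})"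

definition target :: "'l network \<Rightarrow> nat \<Rightarrow> 'l \<Rightarrow> nat option" where
  "target N u p =
     (if p \<in> ports N u then Some (THE v. (u, v) \<in> edges N \<and> label N u v = p) else None)"


section \<open>Agents\<close>

text \<open>
  Type variables: \<open>'i\<close> agent identifiers, \<open>'s\<close> control states of an agent, \<open>'l\<close> link labels,
  \<open>'w\<close> control contents of a whiteboard, \<open>'g\<close> pieces of gossip information.

  The memory of an agent consists of a control state and of the store of gossip information it
  has collected. A whiteboard carries control information, a list of count-up timers, and
  gossip information.
\<close>

type_synonym 'w control = "'w \<times> nat list"

record ('i, 's, 'l, 'w, 'g) view =
  my_id :: 'i
  my_gossip :: 'g
  my_state :: 's
  my_store :: "'g set"
  others :: "'i \<Rightarrow> ('s \<times> 'g set) option"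
  local_ports :: "'l set"
  came_by :: "'l option"
  read_control :: "'w control option"
  read_gossip :: "'g set"

text \<open>
  The answer of an algorithm is the new control state, the new control contents of the
  whiteboard, and the label of the link to move along (\<open>None\<close>: stay).
\<close>

type_synonym ('i, 's, 'l, 'w, 'g) algorithm =
  "('i, 's, 'l, 'w, 'g) view \<Rightarrow> 's \<times> 'w control \<times> 'l option"

definition rename_gossip ::
  "('g \<Rightarrow> 'g) \<Rightarrow> ('i, 's, 'l, 'w, 'g) view \<Rightarrow> ('i, 's, 'l, 'w, 'g) view" where
  "rename_gossip \<pi> x = x\<lparr>
     my_gossip := \<pi> (my_gossip x),
     my_store := \<pi> ` my_store x,
     others := (\<lambda>j. map_option (\<lambda>(s, K). (s, \<pi> ` K)) (others x j)),
     read_gossip := \<pi> ` read_gossip x\<rparr>"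

text \<open>
  Gossip information is opaque: an algorithm may compare pieces of gossip for equality, but the
  pieces themselves have no influence on its behaviour, nor can they be encoded in control
  information.
\<close>

definition opaque :: "('i, 's, 'l, 'w, 'g) algorithm \<Rightarrow> bool" where
  "opaque A \<longleftrightarrow> (\<forall>\<pi> x. bij \<pi> \<longrightarrow> A (rename_gossip \<pi> x) = A x)"


section \<open>Configurations and steps\<close>

text \<open>
  \<open>incoming c i\<close> is the label, at the current node of \<open>i\<close>, of the link by which \<open>i\<close> arrived there.
  Only the entries of agents and nodes that are present are meaningful. The components of a
  whiteboard that the capacity does not provide are never read or written by an agent.
\<close>

record ('i, 's, 'l, 'w, 'g) config =
  loc :: "'i \<Rightarrow> nat"
  state :: "'i \<Rightarrow> 's"
  store :: "'i \<Rightarrow> 'g set"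
  incoming :: "'i \<Rightarrow> 'l option"
  control :: "nat \<Rightarrow> 'w control"
  written :: "nat \<Rightarrow> 'g set"

definition legal_config ::
  "'l network \<Rightarrow> ('i \<Rightarrow> 'g) \<Rightarrow> 'i set \<Rightarrow> ('i, 's, 'l, 'w, 'g) config \<Rightarrow> bool" where
  "legal_config N g I c \<longleftrightarrow>
     (\<forall>i\<in>I. loc c i \<in> nodes N \<and> finite (store c i) \<and> g i \<in> store c i \<and>
        set_option (incoming c i) \<subseteq> ports N (loc c i)) \<and>
     (\<forall>v\<in>nodes N. finite (written c v))"

definition present :: "'i set \<Rightarrow> ('i, 's, 'l, 'w, 'g) config \<Rightarrow> nat \<Rightarrow> 'i set" where
  "present I c v = {j \<in> I. loc c j = v}"

definition readable_gossip ::
  "model \<Rightarrow> ('i, 's, 'l, 'w, 'g) config \<Rightarrow> nat \<Rightarrow> 'g set" where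
  "readable_gossip m c v = (if capacity m = FW then written c v else {})"

definition view_of ::
  "model \<Rightarrow> 'l network \<Rightarrow> ('i \<Rightarrow> 'g) \<Rightarrow> 'i set \<Rightarrow> ('i, 's, 'l, 'w, 'g) config \<Rightarrow> 'i
    \<Rightarrow> ('i, 's, 'l, 'w, 'g) view" where
  "view_of m N g I c i = \<lparr>
     my_id = i,
     my_gossip = g i,
     my_state = state c i,
     my_store = store c i,
     others = (\<lambda>j. if j \<in> present I c (loc c i) - {i} then Some (state c j, store c j) else None),
     local_ports = ports N (loc c i),
     came_by = incoming c i,
     read_control = (if capacity m = NW then None else Some (control c (loc c i))),
     read_gossip = readable_gossip m c (loc c i)\<rparr>"

text \<open>
  The action of one agent, except for its move. Whenever an agent acts, all agents at its node
  exchange all the gossip information they hold, also reading it from and writing it to the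
  whiteboard if gossip may be stored there.
\<close>

definition act ::
  "model \<Rightarrow> ('i, 's, 'l, 'w, 'g) algorithm \<Rightarrow> 'l network \<Rightarrow> ('i \<Rightarrow> 'g) \<Rightarrow> 'i set
    \<Rightarrow> 'i \<Rightarrow> ('i, 's, 'l, 'w, 'g) config \<Rightarrow> ('i, 's, 'l, 'w, 'g) config" where
  "act m A N g I i c =
     (let v = loc c i;
          (s, w, _) = A (view_of m N g I c i);
          K = (\<Union>j\<in>present I c v. store c j) \<union> readable_gossip m c v
      in c\<lparr>state := (state c)(i := s),
           store := (\<lambda>j. if j \<in> present I c v then K else store c j),
           control := (if capacity m = NW then control c else (control c)(v := w)),
           written := (if capacity m = FW then (written c)(v := K) else written c)\<rparr>)"

definition destination ::
  "model \<Rightarrow> ('i, 's, 'l, 'w, 'g) algorithm \<Rightarrow> 'l network \<Rightarrow> ('i \<Rightarrow> 'g) \<Rightarrow> 'i set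
    \<Rightarrow> 'i \<Rightarrow> ('i, 's, 'l, 'w, 'g) config \<Rightarrow> nat option" where
  "destination m A N g I i c =
     (let (_, _, p) = A (view_of m N g I c i) in Option.bind p (target N (loc c i)))"

text \<open>
  Lets the agents of a list act one after the other; their moves are collected, to be performed
  simultaneously afterwards.
\<close>

fun acts ::
  "model \<Rightarrow> ('i, 's, 'l, 'w, 'g) algorithm \<Rightarrow> 'l network \<Rightarrow> ('i \<Rightarrow> 'g) \<Rightarrow> 'i set
    \<Rightarrow> 'i list \<Rightarrow> ('i, 's, 'l, 'w, 'g) config
    \<Rightarrow> ('i, 's, 'l, 'w, 'g) config \<times> ('i \<Rightarrow> nat option)" where
  "acts m A N g I [] c = (c, \<lambda>_. None)"
| "acts m A N g I (i # is) c =
     (let (c', mv) = acts m A N g I is (act m A N g I i c)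
      in (c', mv(i := destination m A N g I i c)))"

text \<open>
  \<open>R\<close> is the set of directed links along which some agent tries to move and \<open>P\<close> the set of
  those which can be used. On a half-duplex link requested in both directions, exactly one of
  the directions can be used (either one).
\<close>

fun passable :: "duplexity \<Rightarrow> (nat \<times> nat) set \<Rightarrow> (nat \<times> nat) set \<Rightarrow> bool" where
  "passable Full_Duplex R P \<longleftrightarrow> P = R"
| "passable Half_Duplex R P \<longleftrightarrow> P \<subseteq> R \<and> (\<forall>(u, v)\<in>R. (u, v) \<in> P \<longleftrightarrow> (v, u) \<notin> P)"

definition requests ::
  "('i, 's, 'l, 'w, 'g) config \<Rightarrow> ('i \<Rightarrow> nat option) \<Rightarrow> (nat \<times> nat) set" where
  "requests c mv = {(loc c i, v) | i v. mv i = Some v}"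

definition relocate ::
  "'l network \<Rightarrow> (nat \<times> nat) set \<Rightarrow> ('i \<Rightarrow> nat option)
    \<Rightarrow> ('i, 's, 'l, 'w, 'g) config \<Rightarrow> ('i, 's, 'l, 'w, 'g) config" where
  "relocate N P mv c = c\<lparr>
     loc := (\<lambda>i. case mv i of
        Some v \<Rightarrow> if (loc c i, v) \<in> P then v else loc c i
      | None \<Rightarrow> loc c i),
     incoming := (\<lambda>i. case mv i of
        Some v \<Rightarrow> if (loc c i, v) \<in> P then Some (label N v (loc c i)) else incoming c i
      | None \<Rightarrow> incoming c i)\<rparr>"

text \<open>The timers run in the synchronous models only; otherwise they are plain control data.\<close>

definition tick ::
  "model \<Rightarrow> ('i, 's, 'l, 'w, 'g) config \<Rightarrow> ('i, 's, 'l, 'w, 'g) config" where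
  "tick m c =
     (if timing m = Synchronous then c\<lparr>control := (\<lambda>v. apsnd (map Suc) (control c v))\<rparr> else c)"

text \<open>
  In a synchronous round all agents act, those at the same node in an arbitrary order. In an
  asynchronous step, any set of agents at pairwise different nodes act concurrently.
\<close>

fun schedulable ::
  "timing \<Rightarrow> 'i set \<Rightarrow> ('i, 's, 'l, 'w, 'g) config \<Rightarrow> 'i list \<Rightarrow> bool" where
  "schedulable Synchronous I c is \<longleftrightarrow> distinct is \<and> set is = I"
| "schedulable Asynchronous I c is \<longleftrightarrow> distinct is \<and> set is \<subseteq> I \<and> inj_on (loc c) (set is)"

definition step ::
  "model \<Rightarrow> ('i, 's, 'l, 'w, 'g) algorithm \<Rightarrow> 'l network \<Rightarrow> ('i \<Rightarrow> 'g) \<Rightarrow> 'i set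
    \<Rightarrow> 'i list \<Rightarrow> ('i, 's, 'l, 'w, 'g) config \<Rightarrow> ('i, 's, 'l, 'w, 'g) config \<Rightarrow> bool" where
  "step m A N g I is c c' \<longleftrightarrow>
     schedulable (timing m) I c is \<and>
     (let (c1, mv) = acts m A N g I is c
      in \<exists>P. passable (duplexity m) (requests c1 mv) P \<and> c' = tick m (relocate N P mv c1))"

definition execution ::
  "model \<Rightarrow> ('i, 's, 'l, 'w, 'g) algorithm \<Rightarrow> 'l network \<Rightarrow> ('i \<Rightarrow> 'g) \<Rightarrow> 'i set
    \<Rightarrow> (nat \<Rightarrow> ('i, 's, 'l, 'w, 'g) config) \<Rightarrow> bool" where
  "execution m A N g I e \<longleftrightarrow>
     legal_config N g I (e 0) \<and>
     (\<exists>\<sigma>. (\<forall>t. step m A N g I (\<sigma> t) (e t) (e (Suc t))) \<and>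
          (\<forall>i\<in>I. \<exists>\<^sub>\<infinity>t. i \<in> set (\<sigma> t)))"


section \<open>Self-stabilizing gossip and quiescence\<close>

definition self_stabilizing_gossip ::
  "model \<Rightarrow> ('i, 's, 'l, 'w, 'g) algorithm \<Rightarrow> bool" where
  "self_stabilizing_gossip m A \<longleftrightarrow>
     opaque A \<and>
     (\<forall>N I g e. network N \<and> finite I \<and> execution m A N g I e \<longrightarrow>
        (\<forall>i\<in>I. \<exists>t. g ` I \<subseteq> store (e t) i))"

text \<open>\<open>quiescent m A l k\<close>: the algorithm is \<open>l\<close>-quiescent when \<open>k\<close> agents are present.\<close>

definition quiescent ::
  "model \<Rightarrow> ('i, 's, 'l, 'w, 'g) algorithm \<Rightarrow> nat \<Rightarrow> nat \<Rightarrow> bool" where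
  "quiescent m A l k \<longleftrightarrow>
     (\<forall>N I g e. network N \<and> finite I \<and> card I = k \<and> execution m A N g I e \<longrightarrow>
        (\<exists>t. \<exists>L\<subseteq>I. l \<le> card L \<and> (\<forall>i\<in>L. \<forall>t'\<ge>t. loc (e t') i = loc (e t) i)))"

end

theory Submission
  imports Defs
begin

text \<open>
  Run the algorithm with \<open>k\<close> agents on a complete graph with \<open>k + 1\<close> nodes, and, with \<open>k\<close> other
  agents and a different piece of gossip, on a disjoint copy of it. Once all agents stay put
  forever, each of the graphs has an empty node; joining these two nodes by a link cannot be
  noticed by any agent. The two runs thus continue side by side as a single execution on the
  joined network, started in a legal configuration, and the two groups never meet.
\<close>

section \<open>Invariants of steps\<close>

lemma target_edge:
  assumes "network N" "target N u p = Some v"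
  shows "(u, v) \<in> edges N"
proof -
  from assms(2) have p: "p \<in> ports N u"
    and v: "v = (THE v. (u, v) \<in> edges N \<and> label N u v = p)"
    by (auto simp: target_def split: if_splits)
  from p obtain w where w: "(u, w) \<in> edges N" "label N u w = p"
    by (auto simp: ports_def)
  with assms(1) have "inj_on (label N u) (edges N `` {u})"
    by (auto simp: network_def)
  with w have "v = w"
    unfolding v by (intro the_equality) (auto dest: inj_onD)
  with w show ?thesis by simp
qed

lemma network_irrefl: "network N \<Longrightarrow> (u, u) \<notin> edges N"
  by (auto simp: network_def irrefl_def)

lemma act_loc [simp]: "loc (act m A N g I i c) = loc c"
  by (auto simp: act_def Let_def split: prod.splits)

lemma destination_edge:
  "network N \<Longrightarrow> destination m A N g I i c = Some v \<Longrightarrow> (loc c i, v) \<in> edges N"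
  by (auto simp: destination_def split: prod.splits bind_splits intro: target_edge)

text \<open>\<open>act\<close> never changes a location, so each destination, although computed in
  an intermediate configuration, is adjacent to the node occupied before the list acts.\<close>

lemma acts_loc_moves:
  assumes "network N" "acts m A N g I is c = (c', mv)"
  shows "loc c' = loc c \<and>
    (\<forall>i v. mv i = Some v \<longrightarrow> i \<in> set is \<and> (loc c i, v) \<in> edges N)"
  using assms(2)
proof (induction "is" arbitrary: c c' mv)
  case (Cons i "is")
  obtain mv' where a: "acts m A N g I is (act m A N g I i c) = (c', mv')"
    and mv: "mv = mv'(i := destination m A N g I i c)"
    using Cons.prems by (auto split: prod.splits)
  show ?case
    using Cons.IH[OF a] destination_edge[OF assms(1), of m A g I i c] by (simp add: mv)
qed auto

text \<open>Glues the schedules of two groups into one list. Agents of \<open>xs\<close> keep their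
  own moves because \<open>acts\<close> enters the move of the head last.\<close>

lemma acts_append:
  assumes "acts m A N g I xs c = (c', mv)" "acts m A N g I ys c' = (c'', mv')"
  shows "acts m A N g I (xs @ ys) c = (c'', \<lambda>i. if i \<in> set xs then mv i else mv' i)"
  using assms(1)
proof (induction xs arbitrary: c mv)
  case (Cons x xs)
  then obtain mv0 where "acts m A N g I xs (act m A N g I x c) = (c', mv0)"
    and "mv = mv0(x := destination m A N g I x c)"
    by (auto split: prod.splits)
  with Cons.IH[of _ mv0] show ?case
    by (auto simp: fun_eq_iff)
qed (use assms(2) in auto)

lemma acts_invariant:
  assumes "acts m A N g I is c = (c', mv)" "Q c"
    and "\<And>i c. i \<in> set is \<Longrightarrow> Q c \<Longrightarrow> Q (act m A N g I i c)"
  shows "Q c'"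
  using assms
proof (induction "is" arbitrary: c mv)
  case (Cons i "is")
  then obtain mv0 where "acts m A N g I is (act m A N g I i c) = (c', mv0)"
    by (auto split: prod.splits)
  then show ?case
    by (rule Cons.IH) (use Cons.prems in auto)
qed auto

lemma schedulable_subset: "schedulable T I c is \<Longrightarrow> set is \<subseteq> I"
  by (cases T) auto

lemma passable_subset: "passable d R P \<Longrightarrow> P \<subseteq> R"
  by (cases d) auto

text \<open>Loops must be excluded: for a request \<open>(u, u)\<close> the half-duplex condition
  would contradict itself.\<close>

lemma passable_exists:
  assumes "\<And>u. (u, u) \<notin> R"
  shows "\<exists>P. passable d R P"
proof (cases d)
  case Half_Duplex
  \<comment> \<open>A link requested in both directions is granted towards the larger node.\<close>
  have "passable Half_Duplex R {(u, v) \<in> R. u < v \<or> (v, u) \<notin> R}"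
    using assms by (auto simp: not_less)
  with Half_Duplex show ?thesis by blast
qed auto

lemma stepE:
  assumes "step m A N g I is c c'"
  obtains c1 mv P where "schedulable (timing m) I c is" "acts m A N g I is c = (c1, mv)"
    "passable (duplexity m) (requests c1 mv) P" "c' = tick m (relocate N P mv c1)"
  using assms by (auto simp: step_def split: prod.splits)

lemma tick_simps [simp]:
  "loc (tick m c) = loc c" "state (tick m c) = state c" "store (tick m c) = store c"
  "incoming (tick m c) = incoming c" "written (tick m c) = written c"
  by (auto simp: tick_def)

lemma relocate_simps [simp]:
  "state (relocate N P mv c) = state c" "store (relocate N P mv c) = store c"
  "written (relocate N P mv c) = written c"
  by (auto simp: relocate_def)

section \<open>Legality and gossip bounds along executions\<close>

lemma act_legal:
  assumes "legal_config N g I c" "finite I" "i \<in> I"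
  shows "legal_config N g I (act m A N g I i c)"
  using assms
  by (auto simp: legal_config_def act_def Let_def present_def readable_gossip_def
      split: prod.splits)

text \<open>Needed because the joined execution starts from late configurations of two other
  executions, which must still be legal.\<close>

lemma step_legal:
  assumes "network N" "finite I" "legal_config N g I c" "step m A N g I is c c'"
  shows "legal_config N g I c'"
proof -
  from assms(4) obtain c1 mv P where s: "schedulable (timing m) I c is"
    and a: "acts m A N g I is c = (c1, mv)" and c': "c' = tick m (relocate N P mv c1)"
    by (rule stepE)
  have "legal_config N g I c1"
    using a assms(3) by (rule acts_invariant)
      (use schedulable_subset[OF s] act_legal[OF _ assms(2)] in blast)
  \<comment> \<open>Symmetry of the edges makes the label recorded in \<open>incoming\<close> on
    arrival a port of the new node.\<close>
  moreover have "v \<in> nodes N \<and> label N v (loc c1 i) \<in> ports N v" if "mv i = Some v" for i v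
  proof -
    have "(loc c1 i, v) \<in> edges N"
      using acts_loc_moves[OF assms(1) a] that by auto
    then have "(v, loc c1 i) \<in> edges N" "v \<in> nodes N"
      using assms(1) by (auto simp: network_def dest: symD)
    then show ?thesis by (auto simp: ports_def)
  qed
  ultimately show ?thesis
    unfolding c' legal_config_def by (auto simp: relocate_def split: option.split)
qed

text \<open>Gossip is only copied between agents and whiteboards, never created. Whiteboards are
  bounded too, since agents read them under \<open>FW\<close>.\<close>

lemma step_gossip_bound:
  assumes "step m A N g I is c c'"
    and "(\<forall>i\<in>I. store c i \<subseteq> S) \<and> (\<forall>v. written c v \<subseteq> S)"
  shows "(\<forall>i\<in>I. store c' i \<subseteq> S) \<and> (\<forall>v. written c' v \<subseteq> S)"
proof -
  from assms(1) obtain c1 mv P where s: "schedulable (timing m) I c is"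
    and a: "acts m A N g I is c = (c1, mv)" and c': "c' = tick m (relocate N P mv c1)"
    by (rule stepE)
  have "(\<forall>i\<in>I. store c1 i \<subseteq> S) \<and> (\<forall>v. written c1 v \<subseteq> S)"
    using a assms(2) by (rule acts_invariant)
      (auto simp: act_def Let_def present_def readable_gossip_def split: prod.splits;
        blast)
  then show ?thesis by (simp add: c')
qed

lemma execution_legal:
  assumes "network N" "finite I" "execution m A N g I e"
  shows "legal_config N g I (e t)"
  using assms by (induction t) (auto simp: execution_def intro: step_legal)

lemma execution_gossip_bound:
  assumes "execution m A N g I e"
    and "\<forall>i\<in>I. store (e 0) i \<subseteq> S" "\<forall>v. written (e 0) v \<subseteq> S"
  shows "(\<forall>i\<in>I. store (e t) i \<subseteq> S) \<and> (\<forall>v. written (e t) v \<subseteq> S)"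
proof (induction t)
  case (Suc t)
  from assms(1) obtain \<sigma> where "step m A N g I (\<sigma> t) (e t) (e (Suc t))"
    by (auto simp: execution_def)
  then show ?case using Suc by (rule step_gossip_bound)
qed (use assms in auto)

section \<open>Existence of fair executions\<close>

lemma step_exists:
  assumes "network N" "schedulable (timing m) I c is"
  shows "\<exists>c'. step m A N g I is c c'"
proof -
  obtain c1 mv where a: "acts m A N g I is c = (c1, mv)" by fastforce
  have "(u, u) \<notin> requests c1 mv" for u
    using acts_loc_moves[OF assms(1) a] network_irrefl[OF assms(1)]
    by (auto simp: requests_def)
  then obtain P where "passable (duplexity m) (requests c1 mv) P"
    using passable_exists by blast
  with assms(2) a show ?thesis by (auto simp: step_def)
qed

text \<open>Quiescence is a statement about all executions; an actual one is needed to extract a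
  motionless tail.\<close>

lemma execution_exists:
  assumes "network N" "finite I" "I \<noteq> {}" "legal_config N g I c"
  shows "\<exists>e. execution m A N g I e \<and> e 0 = c"
proof -
  obtain xs where xs: "distinct xs" "set xs = I"
    using finite_distinct_list[OF assms(2)] by blast
  \<comment> \<open>All agents in each synchronous round; a round robin of single agents otherwise,
    for which injectivity of locations is trivial.\<close>
  define \<sigma> where "\<sigma> t = (if timing m = Synchronous then xs else [xs ! (t mod length xs)])" for t
  have len: "length xs > 0" using xs assms(3) by auto
  have sched: "schedulable (timing m) I c' (\<sigma> t)" for c' and t
    using xs len nth_mem[of "t mod length xs" xs] by (cases "timing m") (auto simp: \<sigma>_def)
  \<comment> \<open>Dependent choice, as half-duplex conflicts may leave several successors.\<close>
  have "\<exists>e. \<forall>t. (t = 0 \<longrightarrow> e t = c) \<and> step m A N g I (\<sigma> t) (e t) (e (Suc t))"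
    by (rule dependent_nat_choice[where P = "\<lambda>t x. t = 0 \<longrightarrow> x = c"])
      (simp_all add: step_exists[OF assms(1) sched])
  then obtain e where "\<forall>t. (t = 0 \<longrightarrow> e t = c) \<and> step m A N g I (\<sigma> t) (e t) (e (Suc t))" ..
  then have e: "e 0 = c" "\<forall>t. step m A N g I (\<sigma> t) (e t) (e (Suc t))"
    by simp_all
  have "\<exists>\<^sub>\<infinity>t. i \<in> set (\<sigma> t)" if i: "i \<in> I" for i
    unfolding INFM_nat_le
  proof
    fix n
    obtain p where p: "p < length xs" "xs ! p = i"
      using i xs by (metis in_set_conv_nth)
    \<comment> \<open>In the round robin, position \<open>p\<close> is served at the times congruent
      to \<open>p\<close> modulo \<open>length xs\<close>.\<close>
    have "i \<in> set (\<sigma> (n * length xs + p))"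
      using p xs by (simp add: \<sigma>_def i)
    moreover have "n \<le> n * length xs + p"
      using len by (cases "length xs") auto
    ultimately show "\<exists>t\<ge>n. i \<in> set (\<sigma> t)" by blast
  qed
  with e(2) have "execution m A N g I e"
    unfolding execution_def e(1) by (intro conjI exI[of _ \<sigma>] assms(4)) simp_all
  with e(1) show ?thesis by blast
qed

section \<open>Steps without moves\<close>

text \<open>
  If nobody moves, then nobody even tries to: on a half-duplex link an agent can only be blocked
  by another one that crosses the link in the opposite direction.
\<close>

lemma still_step:
  assumes "network N" "step m A N g I is c c'" "\<forall>i\<in>I. loc c' i = loc c i"
  shows "\<exists>c1. acts m A N g I is c = (c1, \<lambda>_. None) \<and> c' = tick m c1"
proof -
  from assms(2) obtain c1 mv P where s: "schedulable (timing m) I c is"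
    and a: "acts m A N g I is c = (c1, mv)"
    and P: "passable (duplexity m) (requests c1 mv) P"
    and c': "c' = tick m (relocate N P mv c1)"
    by (rule stepE)
  note al = acts_loc_moves[OF assms(1) a]
  \<comment> \<open>Without loops, a granted move would change the location of its agent.\<close>
  have no: "(loc c i, v) \<notin> P" if "mv i = Some v" for i v
  proof
    assume "(loc c i, v) \<in> P"
    then have "loc c' i = v"
      using that al by (simp add: c' relocate_def)
    moreover have "i \<in> I" "(loc c i, v) \<in> edges N"
      using that al schedulable_subset[OF s] by auto
    ultimately show False
      using assms(3) network_irrefl[OF assms(1)] by auto
  qed
  have "P = {}"
    using passable_subset[OF P] no al by (auto simp: requests_def)
  with P have R: "requests c1 mv = {}"
    by (cases "duplexity m") auto
  have "mv i = None" for i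
    using R by (cases "mv i") (auto simp: requests_def)
  then have mv: "mv = (\<lambda>_. None)" by auto
  have "relocate N P mv c1 = c1"
    by (simp add: mv relocate_def)
  with a c' mv show ?thesis by simp
qed

text \<open>Counterpart of \<open>still_step\<close>: a motionless step amounts to a list of actions
  followed by \<open>tick\<close>.\<close>

lemma step_without_moves:
  assumes "schedulable (timing m) I c is" "acts m A N g I is c = (c1, \<lambda>_. None)"
  shows "step m A N g I is c (tick m c1)"
proof -
  have "passable (duplexity m) (requests c1 (\<lambda>_. None)) {}"
    by (cases "duplexity m") (auto simp: requests_def)
  moreover have "relocate N {} (\<lambda>_. None) c1 = c1"
    by (simp add: relocate_def)
  ultimately show ?thesis
    using assms by (auto simp: step_def intro!: exI[of _ "{}"])
qed

section \<open>Running two systems side by side\<close>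

text \<open>Agents are split by \<open>J\<close> and nodes by \<open>V\<close>, each against its
  full complement. This makes the operation symmetric, as \<open>merge_swap\<close>
  expresses.\<close>

definition merge ::
  "nat set \<Rightarrow> 'i set \<Rightarrow> ('i, 's, 'l, 'w, 'g) config \<Rightarrow> ('i, 's, 'l, 'w, 'g) config
    \<Rightarrow> ('i, 's, 'l, 'w, 'g) config" where
  "merge V J c d = \<lparr>
     loc = (\<lambda>i. if i \<in> J then loc c i else loc d i),
     state = (\<lambda>i. if i \<in> J then state c i else state d i),
     store = (\<lambda>i. if i \<in> J then store c i else store d i),
     incoming = (\<lambda>i. if i \<in> J then incoming c i else incoming d i),
     control = (\<lambda>v. if v \<in> V then control c v else control d v),
     written = (\<lambda>v. if v \<in> V then written c v else written d v)\<rparr>"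

text \<open>Lets results on actions in the first component be reused for the second.\<close>

lemma merge_swap: "merge V J c d = merge (- V) (- J) d c"
  by (auto simp: merge_def fun_eq_iff)

lemma tick_merge: "tick m (merge V J c d) = merge V J (tick m c) (tick m d)"
  by (auto simp: tick_def merge_def fun_eq_iff)

context
  fixes V :: "nat set" and J I :: "'i set" and c d :: "('i, 's, 'l, 'w, 'g) config"
    and N N' :: "'l network"
  assumes inside: "\<forall>j\<in>I \<inter> J. loc c j \<in> V" and outside: "\<forall>j\<in>I - J. loc d j \<notin> V"
    and agree: "\<forall>j\<in>I \<inter> J. \<forall>p. ports N (loc c j) = ports N' (loc c j) \<and>
      target N (loc c j) p = target N' (loc c j) p"
begin

text \<open>An agent perceives the network only through its current node, where \<open>N\<close> and
  \<open>N'\<close> agree. The agents of \<open>I - J\<close> stand outside \<open>V\<close>, so it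
  meets the same agents in both systems.\<close>

lemma view_of_merge:
  assumes "i \<in> I \<inter> J"
  shows "present I (merge V J c d) (loc c i) = present (I \<inter> J) c (loc c i)"
    and "view_of m N g I (merge V J c d) i = view_of m N' g (I \<inter> J) c i"
proof -
  show *: "present I (merge V J c d) (loc c i) = present (I \<inter> J) c (loc c i)"
  proof -
    have "loc d j \<noteq> loc c i" if "j \<in> I" "j \<notin> J" for j
      using inside outside assms that by (metis DiffI)
    with assms show ?thesis
      by (auto simp: present_def merge_def)
  qed
  have "loc (merge V J c d) i = loc c i"
    using assms by (simp add: merge_def)
  with * show "view_of m N g I (merge V J c d) i = view_of m N' g (I \<inter> J) c i"
    using inside agree assms
    by (auto simp: view_of_def fun_eq_iff readable_gossip_def)
      (auto simp: merge_def present_def)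
qed

text \<open>An action affects only the agents at one node and the whiteboard there. All of these
  belong to the first component, so \<open>d\<close> stays intact.\<close>

lemma act_merge:
  assumes "i \<in> I \<inter> J"
  shows "act m A N g I i (merge V J c d) = merge V J (act m A N' g (I \<inter> J) i c) d"
proof -
  have l: "loc (merge V J c d) i = loc c i"
    using assms by (simp add: merge_def)
  have K: "(\<Union>j\<in>present (I \<inter> J) c (loc c i). store (merge V J c d) j) \<union>
      readable_gossip m (merge V J c d) (loc c i) =
      (\<Union>j\<in>present (I \<inter> J) c (loc c i). store c j) \<union> readable_gossip m c (loc c i)"
    using inside assms by (auto simp: merge_def present_def readable_gossip_def)
  show ?thesis
    unfolding act_def Let_def l view_of_merge[OF assms] K
    using inside assms
    by (auto split: prod.splits) (auto simp: merge_def present_def fun_eq_iff)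
qed

lemma destination_merge:
  assumes "i \<in> I \<inter> J"
  shows "destination m A N g I i (merge V J c d) = destination m A N' g (I \<inter> J) i c"
proof -
  have l: "loc (merge V J c d) i = loc c i"
    using assms by (simp add: merge_def)
  have t: "target N (loc c i) = target N' (loc c i)"
    using agree assms by auto
  show ?thesis
    unfolding destination_def view_of_merge[OF assms] l t ..
qed

end

text \<open>The location and agreement hypotheses survive the induction because \<open>act\<close>
  preserves \<open>loc\<close>.\<close>

lemma acts_merge:
  assumes "\<forall>j\<in>I \<inter> J. loc c j \<in> V" "\<forall>j\<in>I - J. loc d j \<notin> V"
    and "\<forall>j\<in>I \<inter> J. \<forall>p. ports N (loc c j) = ports N' (loc c j) \<and>
      target N (loc c j) p = target N' (loc c j) p"
    and "set is \<subseteq> I \<inter> J" "acts m A N' g (I \<inter> J) is c = (c', mv)"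
  shows "acts m A N g I is (merge V J c d) = (merge V J c' d, mv)"
  using assms
proof (induction "is" arbitrary: c mv)
  case (Cons i "is")
  then obtain mv' where a: "acts m A N' g (I \<inter> J) is (act m A N' g (I \<inter> J) i c) = (c', mv')"
    and mv: "mv = mv'(i := destination m A N' g (I \<inter> J) i c)"
    by (auto split: prod.splits)
  have "acts m A N g I is (merge V J (act m A N' g (I \<inter> J) i c) d) = (merge V J c' d, mv')"
    using Cons.prems a by (intro Cons.IH) auto
  moreover have "i \<in> I \<inter> J"
    using Cons.prems(4) by auto
  ultimately show ?case
    using act_merge[OF Cons.prems(1-3)] destination_merge[OF Cons.prems(1-3)] mv
    by (simp add: fun_upd_def)
qed auto

text \<open>By stillness both steps are mere action lists. In the merged system \<open>I1\<close>
  acts first, then \<open>I2\<close>, and a single \<open>tick\<close> advances the timers of both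
  halves.\<close>

lemma still_step_merge:
  assumes net: "network N1" "network N2" and I: "I1 \<inter> I2 = {}"
    and V: "\<forall>j\<in>I1. loc c j \<in> V" "\<forall>j\<in>I2. loc d j \<notin> V"
    and agree1: "\<forall>j\<in>I1. \<forall>p. ports N (loc c j) = ports N1 (loc c j) \<and>
      target N (loc c j) p = target N1 (loc c j) p"
    and agree2: "\<forall>j\<in>I2. \<forall>p. ports N (loc d j) = ports N2 (loc d j) \<and>
      target N (loc d j) p = target N2 (loc d j) p"
    and c: "step m A N1 g I1 xs c c'" "\<forall>i\<in>I1. loc c' i = loc c i"
    and d: "step m A N2 g I2 ys d d'" "\<forall>i\<in>I2. loc d' i = loc d i"
  shows "step m A N g (I1 \<union> I2) (xs @ ys) (merge V I1 c d) (merge V I1 c' d')"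
proof -
  obtain c1 where c1: "acts m A N1 g I1 xs c = (c1, \<lambda>_. None)" "c' = tick m c1"
    using still_step[OF net(1) c] by blast
  obtain d1 where d1: "acts m A N2 g I2 ys d = (d1, \<lambda>_. None)" "d' = tick m d1"
    using still_step[OF net(2) d] by blast
  have loc: "loc c1 = loc c"
    using acts_loc_moves[OF net(1) c1(1)] by simp
  have sx: "schedulable (timing m) I1 c xs" and sy: "schedulable (timing m) I2 d ys"
    using c(1) d(1) by (auto elim: stepE)
  have sub: "set xs \<subseteq> I1" "set ys \<subseteq> I2"
    using schedulable_subset sx sy by blast+
  have I': "(I1 \<union> I2) \<inter> I1 = I1" "(I1 \<union> I2) \<inter> - I1 = I2" "(I1 \<union> I2) - I1 = I2"
    "(I1 \<union> I2) - - I1 = I1"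
    using I by auto
  have "acts m A N g (I1 \<union> I2) xs (merge V I1 c d) = (merge V I1 c1 d, \<lambda>_. None)"
    by (rule acts_merge[where N' = N1]) (use V agree1 sub c1 in \<open>simp_all add: I'\<close>)
  \<comment> \<open>The same lemma with exchanged components; \<open>I1\<close> has already acted,
    hence \<open>c1\<close> as the passive one.\<close>
  moreover have "acts m A N g (I1 \<union> I2) ys (merge (- V) (- I1) d c1) =
      (merge (- V) (- I1) d1 c1, \<lambda>_. None)"
    by (rule acts_merge[where N' = N2]) (use V agree2 sub d1 loc in \<open>simp_all add: I'\<close>)
  ultimately have a: "acts m A N g (I1 \<union> I2) (xs @ ys) (merge V I1 c d) =
      (merge V I1 c1 d1, \<lambda>_. None)"
    using acts_append by (fastforce simp flip: merge_swap)
  have "schedulable (timing m) (I1 \<union> I2) (merge V I1 c d) (xs @ ys)"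
  proof (cases "timing m")
    case Asynchronous
    \<comment> \<open>Concurrent agents must be at different nodes; those of different groups are
      separated by \<open>V\<close>.\<close>
    have "inj_on (loc (merge V I1 c d)) (set xs \<union> set ys)"
    proof (rule inj_onI)
      fix i j
      assume "i \<in> set xs \<union> set ys" "j \<in> set xs \<union> set ys"
        "loc (merge V I1 c d) i = loc (merge V I1 c d) j"
      moreover have "inj_on (loc c) (set xs)" "inj_on (loc d) (set ys)"
        using sx sy Asynchronous by auto
      ultimately show "i = j"
        using V I sub by (auto simp: merge_def dest: inj_onD split: if_splits) (metis subsetD)+
    qed
    then show ?thesis
      using sx sy sub I Asynchronous by auto
  qed (use sx sy I in auto)
  from step_without_moves[OF this a] show ?thesis
    by (simp add: tick_merge c1 d1)
qed

section \<open>Complete graphs joined by a link\<close>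

definition complete_edges :: "nat set \<Rightarrow> (nat \<times> nat) set" where
  "complete_edges V = {(u, v). u \<in> V \<and> v \<in> V \<and> u \<noteq> v}"

text \<open>A link is labelled by its far end through \<open>f\<close>: injectivity of
  \<open>f\<close> gives locally distinct labels, and adding a link later leaves the other labels
  unchanged.\<close>

definition complete_network :: "(nat \<Rightarrow> 'l) \<Rightarrow> nat set \<Rightarrow> 'l network" where
  "complete_network f V = \<lparr>nodes = V, edges = complete_edges V, label = (\<lambda>u v. f v)\<rparr>"

definition joined_network ::
  "(nat \<Rightarrow> 'l) \<Rightarrow> nat set \<Rightarrow> nat set \<Rightarrow> nat \<Rightarrow> nat \<Rightarrow> 'l network" where
  "joined_network f V W a b =
     \<lparr>nodes = V \<union> W,
      edges = complete_edges V \<union> complete_edges W \<union> {(a, b), (b, a)},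
      label = (\<lambda>u v. f v)\<rparr>"

lemma complete_edges_rtrancl:
  "u \<in> V \<Longrightarrow> v \<in> V \<Longrightarrow> complete_edges V \<subseteq> E \<Longrightarrow> (u, v) \<in> E\<^sup>*"
  by (cases "u = v") (auto simp: complete_edges_def)

lemma network_complete:
  "inj f \<Longrightarrow> finite V \<Longrightarrow> V \<noteq> {} \<Longrightarrow> network (complete_network f V)"
  by (auto simp: network_def complete_network_def complete_edges_rtrancl inj_on_def)
    (auto simp: complete_edges_def sym_def irrefl_def)

lemma network_joined:
  assumes "inj f" "finite V" "finite W" "V \<inter> W = {}" "a \<in> V" "b \<in> W"
  shows "network (joined_network f V W a b)"
proof -
  let ?E = "complete_edges V \<union> complete_edges W \<union> {(a, b), (b, a)}"
  have V: "(u, v) \<in> ?E\<^sup>*" if "u \<in> V" "v \<in> V" for u v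
    using that by (rule complete_edges_rtrancl) auto
  have W: "(u, v) \<in> ?E\<^sup>*" if "u \<in> W" "v \<in> W" for u v
    using that by (rule complete_edges_rtrancl) auto
  have ab: "(a, b) \<in> ?E\<^sup>*" "(b, a) \<in> ?E\<^sup>*" by auto
  \<comment> \<open>All paths are routed through \<open>a\<close>.\<close>
  have "(u, v) \<in> ?E\<^sup>*" if uv: "u \<in> V \<union> W" "v \<in> V \<union> W" for u v
  proof -
    have "(u, a) \<in> ?E\<^sup>*"
      using uv(1) V[OF _ assms(5)] rtrancl_trans[OF W[OF _ assms(6)] ab(2)] by blast
    moreover have "(a, v) \<in> ?E\<^sup>*"
      using uv(2) V[OF assms(5)] rtrancl_trans[OF ab(1) W[OF assms(6)]] by blast
    ultimately show ?thesis by (rule rtrancl_trans)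
  qed
  moreover have "a \<noteq> b" using assms by auto
  ultimately show ?thesis
    using assms unfolding network_def joined_network_def
    by (auto simp: inj_on_def) (auto simp: complete_edges_def sym_def irrefl_def)
qed

lemma joined_network_swap: "joined_network f V W a b = joined_network f W V b a"
  by (auto simp: joined_network_def)

text \<open>The new link is incident only to \<open>a\<close> and \<open>b\<close>, and
  \<open>x\<close> differs from \<open>b\<close> by disjointness.\<close>

lemma joined_network_agrees:
  assumes "V \<inter> W = {}" "b \<in> W" "x \<in> V" "x \<noteq> a"
  shows "ports (joined_network f V W a b) x = ports (complete_network f V) x"
    and "target (joined_network f V W a b) x p = target (complete_network f V) x p"
proof -
  have E: "(x, v) \<in> edges (joined_network f V W a b) \<longleftrightarrow> (x, v) \<in> edges (complete_network f V)"
    for v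
    using assms by (auto simp: joined_network_def complete_network_def complete_edges_def)
  have L: "label (joined_network f V W a b) = label (complete_network f V)"
    by (simp add: joined_network_def complete_network_def)
  show *: "ports (joined_network f V W a b) x = ports (complete_network f V) x"
    using E by (auto simp: ports_def L)
  show "target (joined_network f V W a b) x p = target (complete_network f V) x p"
    by (simp add: target_def * E L)
qed

section \<open>The two runs\<close>

text \<open>The run is the quiescent tail of an execution; \<open>a\<close> is a node that is empty throughout.\<close>

lemma quiescent_run:
  fixes A :: "('i, 's, 'l, 'w, 'g) algorithm"
  assumes "quiescent m A k k" "k \<ge> 1" "finite I" "card I = k"
    and "inj f" "finite V" "card V = Suc k" "\<forall>i\<in>I. g i = x"
  obtains a \<sigma> e where "a \<in> V"
    and "\<And>t. step m A (complete_network f V) g I (\<sigma> t) (e t) (e (Suc t))"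
    and "\<And>i. i \<in> I \<Longrightarrow> \<exists>\<^sub>\<infinity>t. i \<in> set (\<sigma> t)"
    and "\<And>t i. i \<in> I \<Longrightarrow> loc (e t) i = loc (e 0) i"
    and "\<And>t i. i \<in> I \<Longrightarrow> loc (e t) i \<noteq> a"
    and "\<And>t i. i \<in> I \<Longrightarrow> store (e t) i \<subseteq> {x}"
    and "\<And>t. legal_config (complete_network f V) g I (e t)"
proof -
  let ?N = "complete_network f V"
  have "V \<noteq> {}" "I \<noteq> {}" using assms by auto
  then obtain v where "v \<in> V" by blast
  have net: "network ?N"
    using network_complete assms \<open>V \<noteq> {}\<close> by blast
  \<comment> \<open>States and control contents are arbitrary. What matters is that no store or
    whiteboard holds gossip other than \<open>x\<close>.\<close>
  define c :: "('i, 's, 'l, 'w, 'g) config" where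
    "c = \<lparr>loc = (\<lambda>_. v), state = (\<lambda>_. undefined), store = (\<lambda>_. {x}), incoming = (\<lambda>_. None),
      control = (\<lambda>_. (undefined, [])), written = (\<lambda>_. {})\<rparr>"
  have "legal_config ?N g I c"
    using \<open>v \<in> V\<close> assms by (simp add: legal_config_def c_def complete_network_def)
  then obtain e where e: "execution m A ?N g I e" "e 0 = c"
    using execution_exists[OF net \<open>finite I\<close> \<open>I \<noteq> {}\<close>] by blast
  then obtain \<sigma> where \<sigma>: "\<And>t. step m A ?N g I (\<sigma> t) (e t) (e (Suc t))"
    "\<And>i. i \<in> I \<Longrightarrow> \<exists>\<^sub>\<infinity>t. i \<in> set (\<sigma> t)"
    by (auto simp: execution_def)
  obtain t L where L: "L \<subseteq> I" "k \<le> card L" "\<forall>i\<in>L. \<forall>t'\<ge>t. loc (e t') i = loc (e t) i"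
    using assms(1)[unfolded quiescent_def, THEN spec[of _ ?N], THEN spec[of _ I],
        THEN spec[of _ g], THEN spec[of _ e]] net assms(3,4) e(1) by blast
  \<comment> \<open>With \<open>l = k\<close> the still agents are all agents.\<close>
  have "L = I"
    using L assms by (simp add: card_seteq)
  \<comment> \<open>Pigeonhole: \<open>k\<close> agents cannot occupy \<open>Suc k\<close>
    nodes.\<close>
  have "card (loc (e t) ` I) < card V"
    using card_image_le[OF \<open>finite I\<close>, of "loc (e t)"] assms by simp
  then have "\<not> V \<subseteq> loc (e t) ` I"
    using card_mono[of "loc (e t) ` I" V] assms by (meson finite_imageI leD)
  then obtain a where a: "a \<in> V" "a \<notin> loc (e t) ` I" by blast
  have store: "\<forall>i\<in>I. store (e n) i \<subseteq> {x}" for n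
    using execution_gossip_bound[OF e(1), of "{x}" n] by (simp add: e c_def)
  \<comment> \<open>Dropping the first \<open>t\<close> steps keeps the schedule fair.\<close>
  have "\<exists>\<^sub>\<infinity>n. i \<in> set (\<sigma> (t + n))" if i: "i \<in> I" for i
    unfolding INFM_nat_le
  proof
    fix n
    obtain n' where "n' \<ge> t + n" "i \<in> set (\<sigma> n')"
      using \<sigma>(2)[OF i] by (auto simp: INFM_nat_le)
    then show "\<exists>n'\<ge>n. i \<in> set (\<sigma> (t + n'))"
      by (intro exI[of _ "n' - t"]) auto
  qed
  moreover have loc: "loc (e (t + n)) i = loc (e t) i" if "i \<in> I" for i n
    using L(3) \<open>L = I\<close> that le_add1 by blast
  moreover have "loc (e (t + n)) i \<noteq> a" if "i \<in> I" for i n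
    using a(2) that loc[OF that] by auto
  ultimately show thesis
    using a(1) \<sigma>(1) store execution_legal[OF net \<open>finite I\<close> e(1)]
    by (intro that[of a "\<lambda>n. \<sigma> (t + n)" "\<lambda>n. e (t + n)"]) auto
qed

theorem theorem1:
  fixes m :: model and k :: nat
  assumes "k \<ge> 1"
  shows "\<not> (\<exists>A :: ('i::{linorder,infinite}, 's, 'l::infinite, 'w, 'g::infinite) algorithm.
             self_stabilizing_gossip m A \<and> quiescent m A k k)"
proof
  assume "\<exists>A :: ('i, 's, 'l, 'w, 'g) algorithm. self_stabilizing_gossip m A \<and> quiescent m A k k"
  then obtain A :: "('i, 's, 'l, 'w, 'g) algorithm"
    where A: "self_stabilizing_gossip m A" "quiescent m A k k" by blast
  obtain f :: "nat \<Rightarrow> 'l" where f: "inj f"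
    using infinite_countable_subset[OF infinite_UNIV] by blast
  obtain I1 :: "'i set" where I1: "finite I1" "card I1 = k"
    using infinite_arbitrarily_large[OF infinite_UNIV] by blast
  obtain I2 :: "'i set" where I2: "finite I2" "card I2 = k" "I2 \<subseteq> - I1"
    using infinite_arbitrarily_large[of "- I1" k] I1 infinite_UNIV
    by (metis finite_compl)
  obtain x y :: 'g where xy: "x \<noteq> y"
    using ex_new_if_finite[OF infinite_UNIV, of "{undefined :: 'g}"] by auto
  \<comment> \<open>One assignment serves both separate runs and the joined one; it is constant on
    each group, as \<open>quiescent_run\<close> requires.\<close>
  define g where "g i = (if i \<in> I1 then x else y)" for i
  define V W where "V = {..k}" and "W = {Suc k..2 * k + 1}"
  have VW: "finite V" "card V = Suc k" "finite W" "card W = Suc k" "V \<inter> W = {}"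
    by (auto simp: V_def W_def)
  have I12: "I1 \<inter> I2 = {}" using I2 by blast
  let ?N1 = "complete_network f V" and ?N2 = "complete_network f W"
  have g: "\<forall>i\<in>I1. g i = x" "\<forall>i\<in>I2. g i = y"
    using I12 by (auto simp: g_def)
  obtain a \<sigma> c where a: "a \<in> V"
    and c: "\<And>t. step m A ?N1 g I1 (\<sigma> t) (c t) (c (Suc t))"
    and \<sigma>: "\<And>i. i \<in> I1 \<Longrightarrow> \<exists>\<^sub>\<infinity>t. i \<in> set (\<sigma> t)"
    and c_loc: "\<And>t i. i \<in> I1 \<Longrightarrow> loc (c t) i = loc (c 0) i"
    and c_free: "\<And>t i. i \<in> I1 \<Longrightarrow> loc (c t) i \<noteq> a"
    and c_store: "\<And>t i. i \<in> I1 \<Longrightarrow> store (c t) i \<subseteq> {x}"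
    and c_legal: "\<And>t. legal_config ?N1 g I1 (c t)"
    by (rule quiescent_run[OF A(2) assms I1 f VW(1,2) g(1)]; rule that)
  obtain b \<tau> d where b: "b \<in> W"
    and d: "\<And>t. step m A ?N2 g I2 (\<tau> t) (d t) (d (Suc t))"
    and \<tau>: "\<And>i. i \<in> I2 \<Longrightarrow> \<exists>\<^sub>\<infinity>t. i \<in> set (\<tau> t)"
    and d_loc: "\<And>t i. i \<in> I2 \<Longrightarrow> loc (d t) i = loc (d 0) i"
    and d_free: "\<And>t i. i \<in> I2 \<Longrightarrow> loc (d t) i \<noteq> b"
    and d_legal: "\<And>t. legal_config ?N2 g I2 (d t)"
    by (rule quiescent_run[OF A(2) assms I2(1,2) f VW(3,4) g(2)]; rule that)
  define N where "N = joined_network f V W a b"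
  have N: "network N"
    unfolding N_def using f VW a b by (intro network_joined) auto
  have net: "network ?N1" "network ?N2"
    using f VW a b by (auto intro!: network_complete)
  have c_nodes: "loc (c t) i \<in> V" if "i \<in> I1" for t i
    using c_legal that by (simp add: legal_config_def complete_network_def)
  have d_nodes: "loc (d t) i \<in> W" if "i \<in> I2" for t i
    using d_legal that by (simp add: legal_config_def complete_network_def)
  have agree1: "ports N (loc (c t) i) = ports ?N1 (loc (c t) i) \<and>
      target N (loc (c t) i) p = target ?N1 (loc (c t) i) p" if "i \<in> I1" for t i p
    using joined_network_agrees[where f = f, OF VW(5) b c_nodes[OF that] c_free[OF that]]
    by (simp add: N_def)
  have WV: "W \<inter> V = {}" using VW(5) by blast
  have agree2: "ports N (loc (d t) i) = ports ?N2 (loc (d t) i) \<and>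
      target N (loc (d t) i) p = target ?N2 (loc (d t) i) p" if "i \<in> I2" for t i p
    using joined_network_agrees[where f = f, OF WV a d_nodes[OF that] d_free[OF that]]
    by (simp add: N_def joined_network_swap[of f V])
  define e where "e t = merge V I1 (c t) (d t)" for t
  have steps: "step m A N g (I1 \<union> I2) (\<sigma> t @ \<tau> t) (e t) (e (Suc t))" for t
    unfolding e_def
  proof (rule still_step_merge[OF net I12 _ _ _ _ c _ d])
    show "\<forall>j\<in>I2. loc (d t) j \<notin> V" using d_nodes VW(5) by blast
    show "\<forall>i\<in>I1. loc (c (Suc t)) i = loc (c t) i" using c_loc by metis
    show "\<forall>i\<in>I2. loc (d (Suc t)) i = loc (d t) i" using d_loc by metis
  qed (use c_nodes agree1 agree2 in blast)+
  \<comment> \<open>Self-stabilization covers every legal start, so the paired tails may begin at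
    time \<open>0\<close>. Agreement of the ports keeps the \<open>incoming\<close> labels legal in
    \<open>N\<close>.\<close>
  have "legal_config N g (I1 \<union> I2) (e 0)"
  proof -
    have "nodes N = V \<union> W" by (simp add: N_def joined_network_def)
    moreover have "ports N (loc (c 0) i) = ports ?N1 (loc (c 0) i)" if "i \<in> I1" for i
      using agree1 that by blast
    moreover have "ports N (loc (d 0) i) = ports ?N2 (loc (d 0) i)" if "i \<in> I2" for i
      using agree2 that by blast
    ultimately show ?thesis
      using c_legal[of 0] d_legal[of 0] I12 unfolding legal_config_def e_def
      by (auto simp: merge_def complete_network_def)
  qed
  moreover have "\<exists>\<^sub>\<infinity>t. i \<in> set (\<sigma> t @ \<tau> t)" if "i \<in> I1 \<union> I2" for i
    using that \<sigma> \<tau> by (auto simp: INFM_disj_distrib)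
  ultimately have "execution m A N g (I1 \<union> I2) e"
    unfolding execution_def using steps by (auto intro!: exI[of _ "\<lambda>t. \<sigma> t @ \<tau> t"])
  then have gossip: "\<forall>i\<in>I1 \<union> I2. \<exists>t. g ` (I1 \<union> I2) \<subseteq> store (e t) i"
    using A(1)[unfolded self_stabilizing_gossip_def, THEN conjunct2, THEN spec[of _ N],
        THEN spec[of _ "I1 \<union> I2"], THEN spec[of _ g], THEN spec[of _ e]] N I1(1) I2(1)
    by blast
  obtain i j where ij: "i \<in> I1" "j \<in> I2"
    using I1 I2 assms by fastforce
  then obtain t where "g j \<in> store (e t) i"
    using gossip by blast
  \<comment> \<open>In \<open>e\<close> the agents of \<open>I1\<close> hold exactly their stores
    from \<open>c\<close>, which contain at most \<open>x\<close>.\<close>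
  then have "y \<in> store (c t) i"
    using ij g(2) by (simp add: e_def merge_def)
  with c_store[OF ij(1)] xy show False by blast
qed

end
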